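(* Let $\mathcal{C}$ be a set of subsets of $E$ each containing at most one skew pair. Then $\mathcal{C}$ is the set of circuits of an antisymmetric matroid on $E$ if and only if: (C1) $\emptyset\notin\mathcal{C}$; (C2) if $C_1,C_2\in\mathcal{C}$ and $C_1\subseteq C_2$ then $C_1=C_2$; (Orth) $|C_1\cap C_2^*|\ne1$ for all $C_1,C_2\in\mathcal{C}$; (Max) for every transversal $T$ and every $e\in T^*$ there is $C\in\mathcal{C}$ with $C\subseteq T\cup\{e\}$.
   Context: Let $E=[n]\cup[n]^*$ with involution $i\leftrightarrow i^*$ (extended to sets by $X^*=\{x^*:x\in X\}$, with $(i^* )^*=i$). A skew pair is $\{i,i^*\}$; $\mathcal{T}_n$ is the set of transversals ($n$-subsets of $E$ with no skew pair) and $\mathcal{A}_n$ the set of almost-transversals ($n$-subsets with exactly one skew pair). An antisymmetric matroid on $E$ is $(E,\mathcal{B})$ with $\mathcal{B}\subseteq\mathcal{T}_n\cup\mathcal{A}_n$ satisfying (B1) $\mathcal{B}\ne\emptyset$; (B2) for $T\in\mathcal{T}_n$ and distinct skew pairs $p,q$, $(T\cup p)\setminus q\in\mathcal{B}$ iff $(T\cup q)\setminus p\in\mathcal{B}$; (Exch) for $B,B'\in\mathcal{B}$ and $e\in B\setminus B'$ with $B\setminus\{e\}$ having no skew pair and $B'\cup\{e\}$ having exactly one skew pair, there is $f\in B'\setminus B$ with both $(B\setminus\{e\})\cup\{f\}$ and $(B'\cup\{e\})\setminus\{f\}$ in $\mathcal{B}$. A circuit of such a matroid is an inclusion-minimal subset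 $C\subseteq E$ containing at most one skew pair that is not contained in any basis. *)

theory Defs
  imports Main
begin

text \<open>The element \<open>i\<close> of \<open>[n]\<close> is encoded as \<open>(i, False)\<close> and its copy \<open>i\<^sup>*\<close> as \<open>(i, True)\<close>.\<close>

type_synonym elt = "nat \<times> bool"

definition ground :: "nat \<Rightarrow> elt set" where
  "ground n = {1..n} \<times> UNIV"

definition star :: "elt \<Rightarrow> elt" where
  "star x = (fst x, \<not> snd x)"

definition skew_pairs :: "nat \<Rightarrow> elt set set" where
  "skew_pairs n = {{x, star x} | x. x \<in> ground n}"

definition num_skew_pairs :: "nat \<Rightarrow> elt set \<Rightarrow> nat" where
  "num_skew_pairs n X = card {p \<in> skew_pairs n. p \<subseteq> X}"

definition transversals :: "nat \<Rightarrow> elt set set" where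
  "transversals n = {T. T \<subseteq> ground n \<and> card T = n \<and> num_skew_pairs n T = 0}"

definition almost_transversals :: "nat \<Rightarrow> elt set set" where
  "almost_transversals n = {A. A \<subseteq> ground n \<and> card A = n \<and> num_skew_pairs n A = 1}"

locale antisymmetric_matroid =
  fixes n :: nat and \<B> :: "elt set set"
  assumes bases_subset: "\<B> \<subseteq> transversals n \<union> almost_transversals n"
    and B1: "\<B> \<noteq> {}"
    and B2: "\<lbrakk>T \<in> transversals n; p \<in> skew_pairs n; q \<in> skew_pairs n; p \<noteq> q\<rbrakk>
      \<Longrightarrow> (T \<union> p) - q \<in> \<B> \<longleftrightarrow> (T \<union> q) - p \<in> \<B>"
    and Exch: "\<lbrakk>B \<in> \<B>; B' \<in> \<B>; e \<in> B - B';
        num_skew_pairs n (B - {e}) = 0; num_skew_pairs n (B' \<union> {e}) = 1\<rbrakk>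
      \<Longrightarrow> \<exists>f \<in> B' - B. (B - {e}) \<union> {f} \<in> \<B> \<and> (B' \<union> {e}) - {f} \<in> \<B>"

text \<open>The sets among which the circuits are the inclusion-minimal ones: subsets of the ground set
  with at most one skew pair that lie in no basis. The family \<open>\<B>\<close> is that of the bases.\<close>

definition circuit_candidates :: "nat \<Rightarrow> elt set set \<Rightarrow> elt set set" where
  "circuit_candidates n \<B> =
    {C. C \<subseteq> ground n \<and> num_skew_pairs n C \<le> 1 \<and> \<not> (\<exists>B\<in>\<B>. C \<subseteq> B)}"

definition circuits :: "nat \<Rightarrow> elt set set \<Rightarrow> elt set set" where
  "circuits n \<B> = {C \<in> circuit_candidates n \<B>. \<forall>D \<in> circuit_candidates n \<B>. D \<subseteq> C \<longrightarrow> D = C}"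

end

theory Submission
  imports Defs
begin

text \<open>For the backward direction, the bases are the transversals and almost-transversals that contain no
  member of \<open>\<C>\<close>. (Orth) shows that a maximal \<open>\<C>\<close>-free set with at most one skew pair has size \<open>n\<close>, and
  that \<open>T \<union> {a\<^sup>*}\<close> contains exactly one member of \<open>\<C>\<close> when the transversal \<open>T\<close> is a basis. To
  exchange \<open>e\<close>, take a member \<open>C\<close> of \<open>\<C>\<close> inside \<open>B' \<union> {e}\<close> and a member \<open>D\<close> inside
  \<open>(B - {e}) \<union> {a, a\<^sup>*}\<close>, where \<open>{a, a\<^sup>*}\<close> is the pair missed by \<open>B - {e}\<close>. As \<open>e \<in> C \<inter> D\<^sup>*\<close>, (Orth)
  gives a second element \<open>f\<close> of \<open>C \<inter> D\<^sup>*\<close>, and this \<open>f\<close> can be exchanged for \<open>e\<close>.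

  For the forward direction, the point is (Orth). By (B2), the star of the complement of a basis is again a
  basis, so that a basis disjoint from \<open>D\<^sup>*\<close> yields one containing \<open>D\<close>; exchange produces such a
  basis if \<open>C \<inter> D\<^sup>*\<close> is a singleton.\<close>

section \<open>Transversals and almost-transversals\<close>

lemma star_star [simp]: "star (star x) = x"
  by (simp add: star_def)

lemma star_neq [simp]: "star x \<noteq> x" "x \<noteq> star x"
  by (auto simp: star_def prod_eq_iff)

lemma star_eq_iff [simp]: "star x = star y \<longleftrightarrow> x = y"
  by (auto simp: star_def prod_eq_iff)

lemma star_eq_swap: "star x = y \<longleftrightarrow> x = star y"
  by auto

lemma star_ground [simp]: "star x \<in> ground n \<longleftrightarrow> x \<in> ground n"
  by (simp add: star_def ground_def mem_Times_iff)

lemma star_image_iff [simp]: "x \<in> star ` X \<longleftrightarrow> star x \<in> X"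
  by (metis image_iff star_star)

lemma fst_eq_iff: "fst x = fst y \<longleftrightarrow> y = x \<or> y = star x"
  by (cases x; cases y) (auto simp: star_def)

lemma finite_ground [simp]: "finite (ground n)"
  by (simp add: ground_def)

lemma finite_skew_pairs: "finite (skew_pairs n)"
proof -
  have "skew_pairs n = (\<lambda>x. {x, star x}) ` ground n"
    by (auto simp: skew_pairs_def)
  then show ?thesis by simp
qed

lemma skew_pair_in: "x \<in> ground n \<Longrightarrow> {x, star x} \<in> skew_pairs n"
  unfolding skew_pairs_def by blast

lemma num_skew_pairs_eq_0:
  assumes "X \<subseteq> ground n"
  shows "num_skew_pairs n X = 0 \<longleftrightarrow> (\<forall>x\<in>X. star x \<notin> X)"
proof -
  have "num_skew_pairs n X = 0 \<longleftrightarrow> {p \<in> skew_pairs n. p \<subseteq> X} = {}"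
    unfolding num_skew_pairs_def by (simp add: finite_skew_pairs)
  also have "\<dots> \<longleftrightarrow> (\<forall>x\<in>X. star x \<notin> X)"
    using assms by (auto simp: skew_pairs_def)
  finally show ?thesis .
qed

lemma num_skew_pairs_le_1:
  assumes "X \<subseteq> ground n"
  shows "num_skew_pairs n X \<le> 1 \<longleftrightarrow>
    (\<forall>x\<in>X. \<forall>y\<in>X. star x \<in> X \<longrightarrow> star y \<in> X \<longrightarrow> y = x \<or> y = star x)"
proof -
  let ?P = "{p \<in> skew_pairs n. p \<subseteq> X}"
  have "num_skew_pairs n X \<le> 1 \<longleftrightarrow> (\<forall>p\<in>?P. \<forall>q\<in>?P. p = q)"
    unfolding num_skew_pairs_def using card_le_Suc0_iff_eq[of ?P] by (simp add: finite_skew_pairs)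
  also have "\<dots> \<longleftrightarrow> (\<forall>x\<in>X. star x \<in> X \<longrightarrow> (\<forall>y\<in>X. star y \<in> X \<longrightarrow> {x, star x} = {y, star y}))"
  proof -
    have "?P = (\<lambda>x. {x, star x}) ` {x \<in> X. star x \<in> X}"
      using assms by (auto simp: skew_pairs_def)
    then show ?thesis by (simp del: split_paired_All) (simp add: Ball_def imp_conjL del: split_paired_All)
  qed
  also have "\<dots> \<longleftrightarrow> (\<forall>x\<in>X. \<forall>y\<in>X. star x \<in> X \<longrightarrow> star y \<in> X \<longrightarrow> y = x \<or> y = star x)"
    unfolding doubleton_eq_iff star_eq_swap[of _ "star _"] by (auto simp: star_eq_swap)
  finally show ?thesis .
qed

lemma num_skew_pairs_eq_1:
  assumes "X \<subseteq> ground n"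
  shows "num_skew_pairs n X = 1 \<longleftrightarrow>
    (\<exists>x\<in>X. star x \<in> X \<and> (\<forall>y\<in>X. star y \<in> X \<longrightarrow> y = x \<or> y = star x))"
proof -
  have "num_skew_pairs n X = 1 \<longleftrightarrow> num_skew_pairs n X \<le> 1 \<and> num_skew_pairs n X \<noteq> 0"
    by auto
  then show ?thesis
    unfolding num_skew_pairs_le_1[OF assms] num_skew_pairs_eq_0[OF assms] by (metis star_star)
qed

section \<open>Normal forms of transversals and almost-transversals\<close>

lemma card_fst_skew_free: "\<forall>x\<in>X. star x \<notin> X \<Longrightarrow> card (fst ` X) = card X"
  by (intro card_image inj_onI) (metis fst_eq_iff)

lemma fst_ground: "X \<subseteq> ground n \<Longrightarrow> fst ` X \<subseteq> {1..n}"
  by (auto simp: ground_def)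

text \<open>The projection \<open>fst\<close> is injective on a set without a skew pair, so such a
  subset of the ground set has \<open>n\<close> elements exactly when it projects onto
  \<open>{1..n}\<close>, that is, when it meets every skew pair.\<close>

lemma transversals_iff:
  "T \<in> transversals n \<longleftrightarrow> T \<subseteq> ground n \<and> (\<forall>x\<in>ground n. star x \<in> T \<longleftrightarrow> x \<notin> T)"
proof -
  have "card T = n \<longleftrightarrow> (\<forall>x\<in>ground n. x \<in> T \<or> star x \<in> T)"
    if T: "T \<subseteq> ground n" "\<forall>x\<in>T. star x \<notin> T"
  proof -
    have "card T = n \<longleftrightarrow> fst ` T = {1..n}"
      using card_fst_skew_free[OF T(2)] fst_ground[OF T(1)]
      by (metis card_atLeastAtMost card_subset_eq diff_Suc_1 finite_atLeastAtMost)
    also have "\<dots> \<longleftrightarrow> (\<forall>x\<in>ground n. fst x \<in> fst ` T)"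
      using fst_ground[OF T(1)] by (force simp: ground_def)
    also have "\<dots> \<longleftrightarrow> (\<forall>x\<in>ground n. x \<in> T \<or> star x \<in> T)"
      by (auto simp: image_iff fst_eq_iff)
    finally show ?thesis .
  qed
  moreover have "(\<forall>x\<in>T. star x \<notin> T) \<and> (\<forall>x\<in>ground n. x \<in> T \<or> star x \<in> T) \<longleftrightarrow>
      (\<forall>x\<in>ground n. star x \<in> T \<longleftrightarrow> x \<notin> T)" if "T \<subseteq> ground n"
    using that by blast
  ultimately show ?thesis
    unfolding transversals_def mem_Collect_eq using num_skew_pairs_eq_0[of T n] by metis
qed

lemma transversal_ground: "T \<in> transversals n \<Longrightarrow> x \<in> T \<Longrightarrow> x \<in> ground n"
  by (auto simp: transversals_iff)

lemma transversal_star: "T \<in> transversals n \<Longrightarrow> x \<in> ground n \<Longrightarrow> star x \<in> T \<longleftrightarrow> x \<notin> T"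
  by (auto simp: transversals_iff)

lemma transversal_not_star: "T \<in> transversals n \<Longrightarrow> x \<in> T \<Longrightarrow> star x \<notin> T"
  by (auto simp: transversals_iff)

lemma transversal_swap:
  "T \<in> transversals n \<Longrightarrow> a \<in> T \<Longrightarrow> insert (star a) (T - {a}) \<in> transversals n"
  unfolding transversals_iff by (auto simp: star_eq_swap)

lemma transversal_cover:
  assumes "T \<in> transversals n" "a \<in> T" "T' \<in> transversals n" "T - {a} \<subseteq> T'"
  shows "T' = T \<or> T' = insert (star a) (T - {a})"
proof -
  have *: "x \<in> T' \<longleftrightarrow> x \<in> T" if "x \<noteq> a" "x \<noteq> star a" for x
  proof -
    have "x \<in> T'" if "x \<in> T" using that \<open>x \<noteq> a\<close> assms(4) by blast
    moreover have "star x \<in> T'" if "star x \<in> T" using that \<open>x \<noteq> star a\<close> assms(4) by auto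
    ultimately show ?thesis
      using assms(1,3) unfolding transversals_iff by blast
  qed
  have a: "star a \<in> T' \<longleftrightarrow> a \<notin> T'" "star a \<notin> T"
    using assms transversal_ground[OF assms(1,2)] by (auto simp: transversals_iff)
  show ?thesis
  proof (cases "a \<in> T'")
    case True
    then have "T' = T" using * a assms(2) by (metis set_eqI)
    then show ?thesis ..
  next
    case False
    then have "T' = insert (star a) (T - {a})"
      using * a by (intro set_eqI) (metis DiffE DiffI insert_iff singleton_iff)
    then show ?thesis ..
  qed
qed

text \<open>Without one element of its skew pair, an almost-transversal has \<open>n - 1\<close>
  elements in distinct pairs, so it misses exactly one pair. Adding an element \<open>b\<close> of
  the missed pair gives \<open>T\<close>.\<close>

lemma almost_transversals_iff:
  "A \<in> almost_transversals n \<longleftrightarrow>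
    (\<exists>T\<in>transversals n. \<exists>a\<in>T. \<exists>b\<in>T. a \<noteq> b \<and> A = insert (star a) (T - {b}))" (is "_ \<longleftrightarrow> ?R")
proof
  assume A: "A \<in> almost_transversals n"
  then have sub: "A \<subseteq> ground n" and card: "card A = n" and "num_skew_pairs n A = 1"
    by (auto simp: almost_transversals_def)
  then obtain x where x: "x \<in> A" "star x \<in> A" "\<forall>y\<in>A. star y \<in> A \<longrightarrow> y = x \<or> y = star x"
    unfolding num_skew_pairs_eq_1[OF sub] by blast
  define Y where "Y = A - {star x}"
  have free: "\<forall>y\<in>Y. star y \<notin> Y"
    using x by (auto simp: Y_def)
  have "finite A" using sub by (rule finite_subset) simp
  then have cY: "Suc (card (fst ` Y)) = n"
    using x card card_fst_skew_free[OF free] card_Suc_Diff1[of A "star x"] by (simp add: Y_def)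
  moreover have Yg: "Y \<subseteq> ground n" using sub by (auto simp: Y_def)
  ultimately have "fst ` Y \<noteq> {1..n}" by (metis card_atLeastAtMost diff_Suc_1 n_not_Suc_n)
  then obtain i where i: "i \<in> {1..n}" "i \<notin> fst ` Y"
    using fst_ground[OF Yg] by blast
  define b where "b = (i, True)"
  have b: "b \<in> ground n" "b \<notin> Y" "star b \<notin> Y"
    using i by (auto simp: b_def ground_def star_def image_iff)
  have "card (insert b Y) = n"
    using cY b card_fst_skew_free[OF free] finite_subset[OF Yg] by simp
  moreover have "\<forall>y\<in>insert b Y. star y \<notin> insert b Y"
    using free b by (auto simp: star_eq_swap)
  ultimately have "insert b Y \<in> transversals n"
    using b Yg num_skew_pairs_eq_0[of "insert b Y" n] by (simp add: transversals_def)
  moreover have "x \<in> Y" using x by (simp add: Y_def)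
  moreover have "A = insert (star x) (insert b Y - {b})" using x b(2) by (auto simp: Y_def)
  ultimately show ?R using b(2) by (intro bexI[of _ "insert b Y"] bexI[of _ x] bexI[of _ b]) auto
next
  assume ?R
  then obtain T a b where T: "T \<in> transversals n" and a: "a \<in> T" and b: "b \<in> T"
    and ab: "a \<noteq> b" and A: "A = insert (star a) (T - {b})" by blast
  have sub: "A \<subseteq> ground n"
    using T a transversal_ground[OF T] by (auto simp: A)
  have sa: "star a \<notin> T" using transversal_not_star[OF T a] .
  have "finite T" using T by (auto simp: transversals_iff intro: finite_subset)
  moreover have "card T = n" using T by (simp add: transversals_def)
  ultimately have "card A = n"
    using sa b card_Suc_Diff1[of T b] by (simp add: A)
  moreover have "num_skew_pairs n A = 1"
    unfolding num_skew_pairs_eq_1[OF sub]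
    using a ab transversal_not_star[OF T] by (intro bexI[of _ a]) (auto simp: A star_eq_swap)
  ultimately show "A \<in> almost_transversals n"
    using sub by (simp add: almost_transversals_def)
qed

lemma almost_transversalI:
  "T \<in> transversals n \<Longrightarrow> a \<in> T \<Longrightarrow> b \<in> T \<Longrightarrow> a \<noteq> b \<Longrightarrow> insert (star a) (T - {b}) \<in> almost_transversals n"
  unfolding almost_transversals_iff by blast

section \<open>Adding or removing one element\<close>

lemma num_skew_pairs_mono: "X \<subseteq> Y \<Longrightarrow> num_skew_pairs n X \<le> num_skew_pairs n Y"
  unfolding num_skew_pairs_def by (rule card_mono) (auto simp: finite_skew_pairs)

lemma insert_star_transversal:
  assumes "T \<in> transversals n" "a \<in> T" "y \<in> insert (star a) T" "star y \<in> insert (star a) T"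
  shows "y = a \<or> y = star a"
  using assms transversal_not_star[OF assms(1), of y] transversal_not_star[OF assms(1), of "star y"]
  by (metis insertE star_star)

lemma num_skew_pairs_insert_transversal:
  assumes "T \<in> transversals n" "a \<in> T"
  shows "num_skew_pairs n (insert (star a) T) = 1"
proof -
  have "insert (star a) T \<subseteq> ground n" using assms transversal_ground by auto
  then show ?thesis
    using insert_star_transversal[OF assms] assms
    by (subst num_skew_pairs_eq_1) auto
qed

text \<open>The form of the basis that gives up \<open>e\<close> in (Exch). The pair of
  \<open>a\<close> is the one missed by \<open>B - {e}\<close>. Either \<open>B\<close> is a
  transversal and \<open>e = a\<close>, or \<open>{e, star e}\<close> is the skew pair of
  \<open>B\<close> and \<open>star e\<close> stays behind.\<close>

lemma remove_skew_free:
  assumes B: "B \<in> transversals n \<union> almost_transversals n" and e: "e \<in> B"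
    and free: "num_skew_pairs n (B - {e}) = 0"
  obtains T a where "T \<in> transversals n" "a \<in> T" "B - {e} = T - {a}"
    "e = a \<or> a \<noteq> star e \<and> star e \<in> T"
proof (cases "B \<in> transversals n")
  case True
  then show ?thesis using e that[of B e] by auto
next
  case False
  then obtain T p q where T: "T \<in> transversals n" and p: "p \<in> T" and q: "q \<in> T"
    and pq: "p \<noteq> q" and BT: "B = insert (star p) (T - {q})"
    using B unfolding Un_iff almost_transversals_iff by blast
  have sp: "star p \<notin> T" using transversal_not_star[OF T p] .
  have "B - {e} \<subseteq> ground n"
    unfolding BT using transversal_ground[OF T] p by (metis DiffD1 insertE star_ground subsetI)
  then have "\<forall>x\<in>B - {e}. star x \<notin> B - {e}" using free num_skew_pairs_eq_0 by blast
  then have "e = p \<or> e = star p" using p pq by (auto simp: BT)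
  then show ?thesis
  proof
    assume [simp]: "e = star p"
    show ?thesis using T p q pq sp by (intro that[of T q]) (auto simp: BT)
  next
    assume [simp]: "e = p"
    show ?thesis using T p q pq sp
      by (intro that[of "insert (star p) (T - {p})" q] transversal_swap) (auto simp: BT)
  qed
qed

text \<open>The form of the basis that receives \<open>e\<close> in (Exch). If \<open>B\<close>
  already has a skew pair, then \<open>star e\<close> in \<open>B\<close> would create a second one;
  hence \<open>e\<close> belongs to the pair missed by \<open>B\<close>, and \<open>T\<close> may be
  chosen to contain \<open>e\<close>.\<close>

lemma insert_one_skew:
  assumes B: "B \<in> transversals n \<union> almost_transversals n" and e: "e \<in> ground n" "e \<notin> B"
    and one: "num_skew_pairs n (insert e B) = 1"
  obtains T where "T \<in> transversals n" "star e \<in> T" "B = T"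
  | T p where "T \<in> transversals n" "p \<in> T" "e \<in> T" "p \<noteq> e" "B = insert (star p) (T - {e})"
proof (cases "B \<in> transversals n")
  case True
  then show ?thesis using e that(1)[of B] transversal_star[OF True] by auto
next
  case False
  then obtain T p q where T: "T \<in> transversals n" and p: "p \<in> T" and q: "q \<in> T"
    and pq: "p \<noteq> q" and BT: "B = insert (star p) (T - {q})"
    using B unfolding Un_iff almost_transversals_iff by blast
  have sp: "star p \<notin> T" using transversal_not_star[OF T p] .
  have sub: "insert e B \<subseteq> ground n" using T p e transversal_ground[OF T] by (auto simp: BT)
  then have le: "\<forall>x\<in>insert e B. \<forall>y\<in>insert e B. star x \<in> insert e B \<longrightarrow> star y \<in> insert e B \<longrightarrow> y = x \<or> y = star x"
    using one num_skew_pairs_le_1[OF sub] by simp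
  have "star e \<notin> B"
  proof
    assume "star e \<in> B"
    then have "e = p \<or> e = star p" using le p pq by (auto simp: BT)
    then show False using e p pq by (auto simp: BT)
  qed
  then have "e = q \<or> e = star q"
    using e transversal_star[OF T e(1)] by (auto simp: BT star_eq_swap)
  then show ?thesis
  proof
    assume "e = q"
    then show ?thesis using that(2)[of T p] T p q pq BT by auto
  next
    assume [simp]: "e = star q"
    have "p \<noteq> star q" using transversal_not_star[OF T q] p by blast
    then show ?thesis using T p q pq sp transversal_not_star[OF T q]
      by (intro that(2)[of "insert (star q) (T - {q})" p] transversal_swap) (auto simp: BT)
  qed
qed

lemma transversal_pair_rep:
  assumes "T \<in> transversals n" "p \<in> skew_pairs n"
  obtains a where "a \<in> T" "p = {a, star a}"
proof -
  obtain x where "x \<in> ground n" "p = {x, star x}"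
    using assms(2) unfolding skew_pairs_def by blast
  then show ?thesis
    using that[of x] that[of "star x"] transversal_star[OF assms(1), of x] by auto
qed

lemma transversal_exchange_pairs:
  assumes "T \<in> transversals n" "a \<in> T" "b \<in> T" "a \<noteq> b"
  shows "T \<union> {a, star a} - {b, star b} = insert (star a) (T - {b})"
proof -
  have "star b \<notin> T" "a \<noteq> star b" using assms transversal_not_star by blast+
  then show ?thesis using assms by auto
qed

lemma insert_remove_transversal:
  assumes T: "T \<in> transversals n" and a: "a \<in> T" and f: "f \<in> ground n" "f \<notin> T - {a}"
  shows "insert f (T - {a}) \<in> transversals n \<union> almost_transversals n"
proof (cases "f \<in> T")
  case True
  then show ?thesis using T a f by (auto simp: insert_absorb)
next
  case False
  then have "star f \<in> T" using transversal_star[OF T f(1)] by simp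
  then show ?thesis
    using almost_transversalI[OF T, of "star f" a] transversal_swap[OF T, of a] a
    by (cases "star f = a") auto
qed

lemma extend_to_maximal:
  assumes "X \<subseteq> ground n" "P X"
  obtains Y where "X \<subseteq> Y" "Y \<subseteq> ground n" "P Y"
    "\<And>z. z \<in> ground n \<Longrightarrow> z \<notin> Y \<Longrightarrow> \<not> P (insert z Y)"
proof -
  let ?S = "{Y \<in> Pow (ground n). P Y}"
  have "finite ?S" "X \<in> ?S" using assms by simp_all
  from finite_has_maximal2[OF this] obtain Y
    where "Y \<in> ?S" "X \<subseteq> Y" "\<forall>Z\<in>?S. Y \<subseteq> Z \<longrightarrow> Y = Z" by (elim bexE conjE)
  then show ?thesis
    by (intro that[of Y]) (simp, simp, simp, metis (no_types, lifting) Pow_iff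
        insert_iff insert_subset mem_Collect_eq subset_insertI)
qed

section \<open>From circuits to bases\<close>

locale circuit_system =
  fixes n :: nat and \<C> :: "elt set set"
  assumes circuit_ground: "C \<in> \<C> \<Longrightarrow> C \<subseteq> ground n"
    and circuit_num: "C \<in> \<C> \<Longrightarrow> num_skew_pairs n C \<le> 1"
    and C1: "{} \<notin> \<C>"
    and C2: "C \<in> \<C> \<Longrightarrow> D \<in> \<C> \<Longrightarrow> C \<subseteq> D \<Longrightarrow> C = D"
    and Orth: "C \<in> \<C> \<Longrightarrow> D \<in> \<C> \<Longrightarrow> card (C \<inter> star ` D) \<noteq> 1"
    and Max: "T \<in> transversals n \<Longrightarrow> e \<in> star ` T \<Longrightarrow> \<exists>C\<in>\<C>. C \<subseteq> T \<union> {e}"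
begin

text \<open>For subsets of the ground set with at most one skew pair, this turns out to mean
  containment in a basis (\<open>extend_to_basis\<close>).\<close>

definition indep :: "elt set \<Rightarrow> bool" where
  "indep X \<longleftrightarrow> (\<forall>C\<in>\<C>. \<not> C \<subseteq> X)"

lemma indep_subset: "indep X \<Longrightarrow> Y \<subseteq> X \<Longrightarrow> indep Y"
  unfolding indep_def by blast

lemma indep_insertE:
  assumes "indep X" "\<not> indep (insert z X)"
  obtains C where "C \<in> \<C>" "z \<in> C" "C \<subseteq> insert z X"
  using assms unfolding indep_def by blast

text \<open>(Orth) in the form used throughout: an intersection known to contain \<open>x\<close>
  has a second element.\<close>

lemma orthE:
  assumes "C \<in> \<C>" "D \<in> \<C>" "x \<in> C" "star x \<in> D"
  obtains y where "y \<noteq> x" "y \<in> C" "star y \<in> D"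
proof -
  have "C \<inter> star ` D \<noteq> {x}" using Orth[OF assms(1,2)] by auto
  moreover have "x \<in> C \<inter> star ` D" using assms(3,4) by simp
  ultimately obtain y where "y \<noteq> x" "y \<in> C \<inter> star ` D" by blast
  then show ?thesis using that[of y] by simp
qed

lemma circuit_in_insert:
  assumes "T \<in> transversals n" "a \<in> T"
  obtains C where "C \<in> \<C>" "C \<subseteq> insert (star a) T"
  using Max[OF assms(1), of "star a"] assms(2) that by auto

lemma fundamental_circuit:
  assumes "T \<in> transversals n" "indep T" "a \<in> T"
  obtains C where "C \<in> \<C>" "star a \<in> C" "C \<subseteq> insert (star a) T"
proof -
  obtain C where "C \<in> \<C>" "C \<subseteq> insert (star a) T"
    using circuit_in_insert assms by blast
  then show ?thesis using assms(2) that unfolding indep_def by blast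
qed

text \<open>If a maximal set \<open>Y\<close> missed the pair of \<open>x\<close>, there would be
  circuits \<open>C\<close> in \<open>insert x Y\<close> through \<open>x\<close> and
  \<open>D\<close> in \<open>insert (star x) Y\<close> through \<open>star x\<close>. The second
  element \<open>y\<close> given by (Orth) would form a skew pair inside \<open>Y\<close>.\<close>

lemma extend_skew_free:
  assumes X: "X \<subseteq> ground n" "\<forall>x\<in>X. star x \<notin> X" "indep X"
  obtains T where "T \<in> transversals n" "X \<subseteq> T" "indep T"
proof -
  obtain Y where Y: "X \<subseteq> Y" "Y \<subseteq> ground n" "(\<forall>y\<in>Y. star y \<notin> Y) \<and> indep Y"
    and max: "\<And>z. z \<in> ground n \<Longrightarrow> z \<notin> Y \<Longrightarrow>
      \<not> ((\<forall>y\<in>insert z Y. star y \<notin> insert z Y) \<and> indep (insert z Y))"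
    using extend_to_maximal[of X n "\<lambda>Y. (\<forall>y\<in>Y. star y \<notin> Y) \<and> indep Y"] X by blast
  have free: "star y \<notin> Y" if "y \<in> Y" for y using Y that by blast
  have "star x \<in> Y \<longleftrightarrow> x \<notin> Y" if x: "x \<in> ground n" for x
  proof (rule ccontr)
    assume "(star x \<in> Y) \<noteq> (x \<notin> Y)"
    then have nx: "x \<notin> Y" "star x \<notin> Y" using free[of x] by auto
    have dep: "\<not> indep (insert z Y)" if "z \<in> ground n" "z \<notin> Y" "star z \<notin> Y" for z
    proof
      assume "indep (insert z Y)"
      moreover have "\<forall>y\<in>insert z Y. star y \<notin> insert z Y"
        using that free by (auto simp: star_eq_swap)
      ultimately show False using max[OF that(1,2)] by blast
    qed
    have indY: "indep Y" using Y by blast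
    obtain C where C: "C \<in> \<C>" "x \<in> C" "C \<subseteq> insert x Y"
      using indep_insertE[OF indY dep[OF x nx]] .
    obtain D where D: "D \<in> \<C>" "star x \<in> D" "D \<subseteq> insert (star x) Y"
      using indep_insertE[OF indY dep[of "star x"]] x nx by auto
    obtain y where "y \<noteq> x" "y \<in> C" "star y \<in> D"
      using orthE[OF C(1) D(1) C(2) D(2)] .
    then have "y \<in> Y" "star y \<in> Y" using C D by auto
    then show False using free by blast
  qed
  then have "Y \<in> transversals n" using Y unfolding transversals_iff by blast
  then show ?thesis using that Y by blast
qed

lemma extend_remove:
  assumes T: "T \<in> transversals n" and a: "a \<in> T" and ind: "indep (T - {a})"
  shows "indep T \<or> indep (insert (star a) (T - {a}))"
proof -
  have "T - {a} \<subseteq> ground n" "\<forall>x\<in>T - {a}. star x \<notin> T - {a}"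
    using transversal_ground[OF T] transversal_not_star[OF T] by blast+
  then obtain T' where "T' \<in> transversals n" "T - {a} \<subseteq> T'" "indep T'"
    using extend_skew_free ind by blast
  then show ?thesis using transversal_cover[OF T a] by blast
qed

text \<open>By (C2) one inclusion suffices. An element \<open>f\<close> of \<open>C\<close> outside
  \<open>D\<close>, other than \<open>a\<close>, is detected by a circuit \<open>F\<close> in
  \<open>insert (star f) T\<close>: comparing \<open>F\<close> with \<open>C\<close> forces
  \<open>a\<close> into \<open>F\<close>, and comparing \<open>F\<close> with \<open>D\<close> then
  forces \<open>f\<close> into \<open>D\<close>.\<close>

lemma fundamental_circuit_unique:
  assumes T: "T \<in> transversals n" "indep T" and a: "a \<in> T"
    and C: "C \<in> \<C>" "C \<subseteq> insert (star a) T" and D: "D \<in> \<C>" "D \<subseteq> insert (star a) T"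
  shows "C = D"
proof (rule C2[OF C(1) D(1)], rule subsetI, rule ccontr)
  fix f assume f: "f \<in> C" "f \<notin> D"
  have sa: "star a \<in> C" "star a \<in> D" using C D T(2) unfolding indep_def by blast+
  have nst: "star y \<notin> T" if "y \<in> T" for y using transversal_not_star[OF T(1) that] .
  show False
  proof (cases "f = a")
    case True
    obtain y where y: "y \<noteq> a" "y \<in> C" "star y \<in> D"
      using orthE[OF C(1) D(1), of a] f sa True by blast
    then have "y = star a" using insert_star_transversal[OF T(1) a, of y] C D by blast
    then show False using y f True by simp
  next
    case False
    then have fT: "f \<in> T" using f C sa by blast
    obtain F where F: "F \<in> \<C>" "star f \<in> F" "F \<subseteq> insert (star f) T"
      using fundamental_circuit[OF T fT] .
    obtain y where y: "y \<noteq> f" "y \<in> C" "star y \<in> F"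
      using orthE[OF C(1) F(1) f(1) F(2)] .
    then have "star y \<in> T" using F by auto
    then have "y = star a" using y(2) C nst by blast
    then have "a \<in> F" using y by simp
    then obtain z where z: "z \<noteq> star a" "z \<in> D" "star z \<in> F"
      using orthE[OF D(1) F(1), of "star a"] sa by auto
    then have "z \<in> T" using D by blast
    then have "star z = star f" using z F nst by blast
    then show False using z f by simp
  qed
qed

text \<open>When \<open>T\<close> is independent, a circuit \<open>C\<close> in the second set
  contains \<open>star b\<close>, and a circuit \<open>D\<close> in \<open>insert (star a) T\<close>
  contains \<open>b\<close>, because the first set is independent. There is no room for the second
  element that (Orth) requires.\<close>

lemma indep_exchange_pairs:
  assumes T: "T \<in> transversals n" and a: "a \<in> T" and b: "b \<in> T" and ab: "a \<noteq> b"
    and ind: "indep (insert (star a) (T - {b}))"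
  shows "indep (insert (star b) (T - {a}))"
proof -
  have *: "indep (insert (star b) (T - {a}))"
    if T: "T \<in> transversals n" "indep T" and a: "a \<in> T" and b: "b \<in> T"
      and ind: "indep (insert (star a) (T - {b}))" for T b
  proof (rule ccontr)
    assume "\<not> indep (insert (star b) (T - {a}))"
    then obtain C where C: "C \<in> \<C>" "C \<subseteq> insert (star b) (T - {a})"
      unfolding indep_def by blast
    then have sb: "star b \<in> C" using T(2) unfolding indep_def by blast
    obtain D where D: "D \<in> \<C>" "D \<subseteq> insert (star a) T"
      using circuit_in_insert[OF T(1) a] .
    then have "b \<in> D" using ind unfolding indep_def by blast
    then obtain y where y: "y \<noteq> star b" "y \<in> C" "star y \<in> D"
      using orthE[OF C(1) D(1) sb] by auto
    then have "y \<in> T" "y \<noteq> a" using C by auto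
    then show False using y D transversal_not_star[OF T(1), of y] by auto
  qed
  have sb: "star b \<notin> T" using transversal_not_star[OF T b] .
  have "indep (T - {b})" by (rule indep_subset[OF ind]) blast
  then consider "indep T" | "indep (insert (star b) (T - {b}))"
    using extend_remove[OF T b] by blast
  then show ?thesis
  proof cases
    case 1
    then show ?thesis using * T a b ind by blast
  next
    case 2
    \<comment> \<open>Passing to the transversal with \<open>star b\<close> in place of
      \<open>b\<close>, and renaming \<open>b\<close> to \<open>star b\<close>, leaves both sets
      unchanged, so the case of an independent transversal applies.\<close>
    have "insert (star b) (T - {b}) - {star b} = T - {b}" using sb by blast
    moreover have "insert b (insert (star b) (T - {b}) - {a}) = insert (star b) (T - {a})"
      using a b ab sb by blast
    ultimately show ?thesis
      using *[OF transversal_swap[OF T b] 2, of "star b"] a ab ind by auto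
  qed
qed

text \<open>A maximal \<open>Y\<close> with only the pair of \<open>a\<close> lies in
  \<open>insert (star a) T\<close> for an independent transversal \<open>T\<close>, and properly so,
  since that set contains a circuit. The work is to see that \<open>Y\<close> cannot miss two
  elements \<open>b\<close> and \<open>c\<close> of \<open>T\<close>.\<close>

lemma extend_one_skew:
  assumes X: "X \<subseteq> ground n" "indep X" and a: "a \<in> X" "star a \<in> X"
    and one: "\<forall>y\<in>X. star y \<in> X \<longrightarrow> y = a \<or> y = star a"
  obtains A where "A \<in> almost_transversals n" "X \<subseteq> A" "indep A"
proof -
  obtain Y where Y: "X \<subseteq> Y" "Y \<subseteq> ground n"
      "(\<forall>y\<in>Y. star y \<in> Y \<longrightarrow> y = a \<or> y = star a) \<and> indep Y"
    and max: "\<And>z. z \<in> ground n \<Longrightarrow> z \<notin> Y \<Longrightarrow>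
      \<not> ((\<forall>y\<in>insert z Y. star y \<in> insert z Y \<longrightarrow> y = a \<or> y = star a) \<and> indep (insert z Y))"
    using extend_to_maximal[of X n
        "\<lambda>Y. (\<forall>y\<in>Y. star y \<in> Y \<longrightarrow> y = a \<or> y = star a) \<and> indep Y"] X one by blast
  have one: "y = a \<or> y = star a" if "y \<in> Y" "star y \<in> Y" for y using Y that by blast
  have indY: "indep Y" and Yg: "Y \<subseteq> ground n" and aY: "a \<in> Y" "star a \<in> Y" using Y a by blast+
  have dep: "\<not> indep (insert z Y)" if "z \<in> ground n" "z \<notin> Y" "star z \<notin> Y" for z
  proof
    assume "indep (insert z Y)"
    moreover have "\<forall>y\<in>insert z Y. star y \<in> insert z Y \<longrightarrow> y = a \<or> y = star a"
    proof (intro ballI impI)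
      fix y assume y: "y \<in> insert z Y" "star y \<in> insert z Y"
      have "y \<noteq> z" using y(2) that(3) by auto
      moreover have "star y \<noteq> z" using y(1) that(3) by auto
      ultimately show "y = a \<or> y = star a" using one y by blast
    qed
    ultimately show False using max[OF that(1,2)] by blast
  qed
  have "\<forall>y\<in>Y - {star a}. star y \<notin> Y - {star a}" using one by blast
  moreover have "Y - {star a} \<subseteq> ground n" using Yg by blast
  moreover have "indep (Y - {star a})" by (rule indep_subset[OF indY]) blast
  ultimately obtain T where T: "T \<in> transversals n" "Y - {star a} \<subseteq> T" "indep T"
    using extend_skew_free by blast
  have nst: "star y \<notin> T" if "y \<in> T" for y using transversal_not_star[OF T(1) that] .
  have aT: "a \<in> T" using T aY by auto
  have YT: "Y \<subseteq> insert (star a) T" using T by blast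
  obtain C where "C \<in> \<C>" "C \<subseteq> insert (star a) T" using circuit_in_insert[OF T(1) aT] .
  then have "Y \<noteq> insert (star a) T" using indY unfolding indep_def by blast
  then obtain b where b: "b \<in> T" "b \<notin> Y" using YT aY by blast
  have "Y = insert (star a) (T - {b})"
  proof (rule ccontr)
    assume "Y \<noteq> insert (star a) (T - {b})"
    then obtain c where c: "c \<in> T" "c \<notin> Y" "c \<noteq> b" using YT aY b by blast
    have sY: "star y \<notin> Y" if "y \<in> T" "y \<notin> Y" for y
    proof
      assume "star y \<in> Y"
      then have "star y = star a" using nst[OF that(1)] YT by blast
      then show False using that(2) aY by simp
    qed
    have bg: "b \<in> ground n" and cg: "c \<in> ground n" using b c transversal_ground[OF T(1)] by blast+
    \<comment> \<open>Four circuits lead to a contradiction. Comparing \<open>F\<close> with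
      \<open>D3\<close> puts \<open>a\<close> into \<open>F\<close> and \<open>star a\<close> into
      \<open>D3\<close>; comparing \<open>F\<close> with \<open>D1\<close> keeps
      \<open>star a\<close> out of \<open>D1\<close>; comparing \<open>D1\<close> with
      \<open>D2\<close> then puts \<open>a\<close> into \<open>D1\<close>; finally \<open>D1\<close>
      and \<open>D3\<close> violate (Orth) at \<open>a\<close>.\<close>
    obtain F where F: "F \<in> \<C>" "star c \<in> F" "F \<subseteq> insert (star c) T"
      using fundamental_circuit[OF T(1,3) c(1)] .
    obtain D1 where D1: "D1 \<in> \<C>" "b \<in> D1" "D1 \<subseteq> insert b Y"
      using indep_insertE[OF indY dep[OF bg b(2) sY[OF b]]] by blast
    obtain D2 where D2: "D2 \<in> \<C>" "star b \<in> D2" "D2 \<subseteq> insert (star b) Y"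
      using indep_insertE[OF indY dep[of "star b"]] b bg sY[of b] by auto
    obtain D3 where D3: "D3 \<in> \<C>" "c \<in> D3" "D3 \<subseteq> insert c Y"
      using indep_insertE[OF indY dep[OF cg c(2) sY[OF c(1,2)]]] by blast
    have aF: "a \<in> F" "star a \<in> D3"
    proof -
      obtain y where y: "y \<noteq> star c" "y \<in> F" "star y \<in> D3"
        using orthE[OF F(1) D3(1) F(2)] D3 by auto
      then have yT: "y \<in> T" using F by blast
      moreover have "star y \<noteq> c" using y by auto
      ultimately have "star y = star a" using y D3 YT nst by blast
      then show "a \<in> F" "star a \<in> D3" using y by auto
    qed
    have saD1: "star a \<notin> D1"
    proof
      assume "star a \<in> D1"
      then obtain y where y: "y \<noteq> a" "y \<in> F" "star y \<in> D1"
        using orthE[OF F(1) D1(1) aF(1)] by blast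
      show False
      proof (cases "y = star c")
        case True
        then show False using y D1 c by auto
      next
        case False
        then have "y \<in> T" using y F by blast
        then have "star y \<notin> T" by (rule nst)
        then have "star y = star a" using y(3) D1 YT b by blast
        then show False using y by simp
      qed
    qed
    obtain y where y: "y \<noteq> b" "y \<in> D1" "star y \<in> D2"
      using orthE[OF D1(1) D2(1) D1(2) D2(2)] .
    then have "y \<in> Y" "star y \<in> Y" using D1 D2 by auto
    then have "a \<in> D1" using one y saD1 by blast
    then obtain z where z: "z \<noteq> a" "z \<in> D1" "star z \<in> D3"
      using orthE[OF D1(1) D3(1) _ aF(2)] by blast
    show False
    proof (cases "z = b")
      case True
      then have "star b = c" using z D3 sY b by blast
      then show False using nst b c by blast
    next
      case False
      then have zY: "z \<in> Y" using z D1 by blast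
      have "star z \<noteq> c" using zY sY[OF c(1,2)] by auto
      then have "star z \<in> Y" using z D3 by blast
      then show False using one zY z saD1 by blast
    qed
  qed
  moreover have "a \<noteq> b" using aY b by blast
  ultimately have "Y \<in> almost_transversals n" using almost_transversalI T aT b by blast
  then show ?thesis using that Y indY by blast
qed

section \<open>The matroid defined by the circuits\<close>

definition bases :: "elt set set" where
  "bases = {B \<in> transversals n \<union> almost_transversals n. indep B}"

lemma extend_to_basis:
  assumes X: "X \<subseteq> ground n" "num_skew_pairs n X \<le> 1"
  shows "(\<exists>B\<in>bases. X \<subseteq> B) \<longleftrightarrow> indep X"
proof
  assume "\<exists>B\<in>bases. X \<subseteq> B"
  then show "indep X" unfolding bases_def using indep_subset by blast
next
  assume ind: "indep X"
  show "\<exists>B\<in>bases. X \<subseteq> B"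
  proof (cases "\<forall>x\<in>X. star x \<notin> X")
    case True
    then show ?thesis using extend_skew_free[OF X(1) _ ind] unfolding bases_def by blast
  next
    case False
    then obtain a where a: "a \<in> X" "star a \<in> X" by blast
    then have "\<forall>y\<in>X. star y \<in> X \<longrightarrow> y = a \<or> y = star a"
      using X num_skew_pairs_le_1 by blast
    then show ?thesis using extend_one_skew[OF X(1) ind a] unfolding bases_def by blast
  qed
qed

text \<open>By \<open>extend_to_basis\<close>, the candidates are the subsets of the ground set with
  at most one skew pair that contain a member of \<open>\<C>\<close>, and (C2) makes these members
  the minimal ones.\<close>

lemma circuits_bases: "circuits n bases = \<C>"
proof -
  have cand: "X \<in> circuit_candidates n bases \<longleftrightarrow>
      X \<subseteq> ground n \<and> num_skew_pairs n X \<le> 1 \<and> \<not> indep X" for X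
    unfolding circuit_candidates_def mem_Collect_eq using extend_to_basis[of X] by blast
  have in_cand: "C \<in> circuit_candidates n bases" if "C \<in> \<C>" for C
    unfolding cand indep_def using that circuit_ground[OF that] circuit_num[OF that] by blast
  have below: "\<exists>C\<in>\<C>. C \<subseteq> X" if "X \<in> circuit_candidates n bases" for X
    using that unfolding cand indep_def by simp
  show ?thesis
  proof (intro equalityI subsetI)
    fix X assume "X \<in> circuits n bases"
    then have X: "X \<in> circuit_candidates n bases"
      "\<And>D. D \<in> circuit_candidates n bases \<Longrightarrow> D \<subseteq> X \<Longrightarrow> D = X"
      unfolding circuits_def by simp_all
    obtain C where C: "C \<in> \<C>" "C \<subseteq> X" using below[OF X(1)] by (elim bexE)
    then show "X \<in> \<C>" using X(2)[OF in_cand[OF C(1)] C(2)] by simp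
  next
    fix X assume X: "X \<in> \<C>"
    have "D = X" if D: "D \<in> circuit_candidates n bases" "D \<subseteq> X" for D
    proof -
      obtain C where C: "C \<in> \<C>" "C \<subseteq> D" using below[OF D(1)] by (elim bexE)
      have "C = X" using C2[OF C(1) X subset_trans[OF C(2) D(2)]] .
      then show ?thesis using C D by simp
    qed
    then show "X \<in> circuits n bases" unfolding circuits_def using in_cand[OF X] by simp
  qed
qed

text \<open>Prepares for \<open>fundamental_circuit_unique\<close>. If \<open>B\<close> is
  \<open>insert (star p) (T - {e})\<close>, then \<open>indep_exchange_pairs\<close> makes
  \<open>T - {p}\<close> independent, so \<open>T\<close> or its swap at \<open>p\<close> is
  independent; completing the pair of \<open>p\<close> in either one gives
  \<open>insert e B\<close>.\<close>

lemma insert_basis_transversal: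
  assumes B: "B \<in> bases" and e: "e \<in> ground n" "e \<notin> B"
    and one: "num_skew_pairs n (insert e B) = 1"
  obtains T b where "T \<in> transversals n" "indep T" "b \<in> T" "insert e B = insert (star b) T"
proof -
  have B': "B \<in> transversals n \<union> almost_transversals n" "indep B" using B unfolding bases_def by auto
  show ?thesis
  proof (rule insert_one_skew[OF B'(1) e one])
    fix T assume "T \<in> transversals n" "star e \<in> T" "B = T"
    then show ?thesis using that[of T "star e"] B' by simp
  next
    fix T p assume T: "T \<in> transversals n" and p: "p \<in> T" and eT: "e \<in> T" and pe: "p \<noteq> e"
      and BT: "B = insert (star p) (T - {e})"
    have "indep (insert (star e) (T - {p}))"
      using indep_exchange_pairs[OF T p eT pe] B'(2) BT by simp
    then have "indep (T - {p})" by (rule indep_subset) blast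
    then consider "indep T" | "indep (insert (star p) (T - {p}))"
      using extend_remove[OF T p] by blast
    then show ?thesis
    proof cases
      case 1
      then show ?thesis using that[of T p] T p eT BT by auto
    next
      case 2
      then show ?thesis using that[OF transversal_swap[OF T p], of "star p"] p eT BT pe by auto
    qed
  qed
qed

lemma basis_exchange:
  assumes B: "B \<in> bases" and B': "B' \<in> bases" and e: "e \<in> B - B'"
    and free: "num_skew_pairs n (B - {e}) = 0" and one: "num_skew_pairs n (insert e B') = 1"
  shows "\<exists>f\<in>B' - B. insert f (B - {e}) \<in> bases \<and> insert e B' - {f} \<in> bases"
proof -
  have indB: "indep B" and indB': "indep B'" using B B' unfolding bases_def by auto
  obtain T a where T: "T \<in> transversals n" and a: "a \<in> T" and BT: "B - {e} = T - {a}"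
    and ea: "e = a \<or> a \<noteq> star e \<and> star e \<in> T"
    using remove_skew_free[of B n e] B e free unfolding bases_def by blast
  have nst: "star y \<notin> T" if "y \<in> T" for y using transversal_not_star[OF T that] .
  have B_eq: "B = insert e (T - {a})" using BT e by blast
  have eg: "e \<in> ground n"
    using ea a transversal_ground[OF T] by (metis star_ground)
  obtain D where D: "D \<in> \<C>" "D \<subseteq> insert (star a) T" using circuit_in_insert[OF T a] .
  \<comment> \<open>If \<open>e = a\<close>, then \<open>T\<close> is the independent set
    \<open>B\<close>, so \<open>D\<close> needs \<open>star a\<close>. Otherwise independence of
    \<open>B\<close> passes by \<open>indep_exchange_pairs\<close> to
    \<open>insert (star a) (T - {star e})\<close>, so \<open>D\<close> needs
    \<open>star e\<close>.\<close>
  have eD: "star e \<in> D"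
    using ea
  proof
    assume "e = a"
    then have "B = T" using B_eq a by blast
    then show ?thesis using D indB \<open>e = a\<close> unfolding indep_def by blast
  next
    assume *: "a \<noteq> star e \<and> star e \<in> T"
    then have "indep (insert (star a) (T - {star e}))"
      using indep_exchange_pairs[OF T, of "star e" a] a indB B_eq by auto
    then show ?thesis using D unfolding indep_def by blast
  qed
  obtain T' b where T': "T' \<in> transversals n" "indep T'" and b: "b \<in> T'"
    and BT': "insert e B' = insert (star b) T'"
    using insert_basis_transversal[OF B' eg _ one] e by blast
  obtain C where C: "C \<in> \<C>" "C \<subseteq> insert e B'"
    using circuit_in_insert[OF T'(1) b] BT' by metis
  have eC: "e \<in> C" using C indB' unfolding indep_def by blast
  obtain f where f: "f \<noteq> e" "f \<in> C" "star f \<in> D" using orthE[OF C(1) D(1) eC eD] .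
  have fB': "f \<in> B'" using f C by blast
  have aD: "y = a" if "y \<in> T" "star y \<in> D" for y
    using nst[OF that(1)] that D by auto
  have fT: "f \<notin> T - {a}" using aD f by blast
  then have fB: "f \<notin> B" using f BT by blast
  have fg: "f \<in> ground n" using f C circuit_ground by blast
  \<comment> \<open>The star of \<open>D\<close> is disjoint from \<open>B - {e}\<close>, so a
    circuit in \<open>insert f (B - {e})\<close> would meet it in \<open>f\<close> alone.\<close>
  have "indep (insert f (B - {e}))"
  proof (rule ccontr)
    assume "\<not> indep (insert f (B - {e}))"
    moreover have "indep (B - {e})" by (rule indep_subset[OF indB]) blast
    ultimately obtain C' where C': "C' \<in> \<C>" "f \<in> C'" "C' \<subseteq> insert f (B - {e})"
      using indep_insertE by blast
    obtain y where "y \<noteq> f" "y \<in> C'" "star y \<in> D" using orthE[OF C'(1) D(1) C'(2) f(3)] .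
    then show False using C' aD BT by blast
  qed
  then have "insert f (B - {e}) \<in> bases"
    using insert_remove_transversal[OF T a fg fT] BT unfolding bases_def by simp
  moreover have "insert e B' - {f} \<in> bases"
  proof -
    have "indep (insert e B' - {f})"
      unfolding indep_def
    proof (intro ballI notI)
      fix C' assume C': "C' \<in> \<C>" "C' \<subseteq> insert e B' - {f}"
      \<comment> \<open>\<open>insert e B'\<close> contains no circuit but \<open>C\<close>, and
        removing \<open>f\<close> destroys \<open>C\<close>.\<close>
      have "C = C'"
        using fundamental_circuit_unique[OF T' b] C C' BT' by (metis Diff_subset subset_trans)
      then show False using f C' by blast
    qed
    moreover have "insert e B' - {f} \<in> transversals n \<union> almost_transversals n"
    proof (cases "f = star b")
      case True
      then have "insert e B' - {f} = T'" using BT' transversal_not_star[OF T'(1) b] by auto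
      then show ?thesis using T' by blast
    next
      case False
      then have "f \<in> T'" using BT' fB' by blast
      moreover have "insert e B' - {f} = insert (star b) (T' - {f})" using BT' False by auto
      ultimately show ?thesis
        using almost_transversalI[OF T'(1) b] transversal_swap[OF T'(1)] by (cases "b = f") auto
    qed
    ultimately show ?thesis unfolding bases_def by blast
  qed
  ultimately show ?thesis using fB fB' by blast
qed

lemma antisymmetric_matroid_bases: "antisymmetric_matroid n bases"
proof
  show "bases \<subseteq> transversals n \<union> almost_transversals n" unfolding bases_def by blast
  have "indep {}" using C1 unfolding indep_def by auto
  then show "bases \<noteq> {}"
    using extend_to_basis[of "{}"] num_skew_pairs_eq_0[of "{}" n] by auto
next
  fix T p q
  assume T: "T \<in> transversals n" and "p \<in> skew_pairs n" "q \<in> skew_pairs n" and pq: "p \<noteq> q"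
  then obtain a b where ab: "a \<in> T" "p = {a, star a}" "b \<in> T" "q = {b, star b}"
    using transversal_pair_rep[OF T] by metis
  then have "a \<noteq> b" using pq by blast
  then show "(T \<union> p) - q \<in> bases \<longleftrightarrow> (T \<union> q) - p \<in> bases"
    unfolding ab(2,4) transversal_exchange_pairs[OF T ab(1,3) \<open>a \<noteq> b\<close>]
      transversal_exchange_pairs[OF T ab(3,1) \<open>a \<noteq> b\<close>[symmetric]] bases_def
    using almost_transversalI[OF T ab(1,3)] almost_transversalI[OF T ab(3,1)]
      indep_exchange_pairs[OF T ab(1,3)] indep_exchange_pairs[OF T ab(3,1)] by auto
next
  fix B B' e assume "B \<in> bases" "B' \<in> bases" "e \<in> B - B'"
    "num_skew_pairs n (B - {e}) = 0" "num_skew_pairs n (B' \<union> {e}) = 1"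
  then show "\<exists>f\<in>B' - B. B - {e} \<union> {f} \<in> bases \<and> B' \<union> {e} - {f} \<in> bases"
    using basis_exchange[of B B' e] by simp
qed

end

section \<open>From bases to circuits\<close>

context antisymmetric_matroid
begin

lemma basis_exchange_pairs:
  assumes T: "T \<in> transversals n" and a: "a \<in> T" and b: "b \<in> T" and ab: "a \<noteq> b"
  shows "insert (star a) (T - {b}) \<in> \<B> \<longleftrightarrow> insert (star b) (T - {a}) \<in> \<B>"
proof -
  have "{a, star a} \<in> skew_pairs n" "{b, star b} \<in> skew_pairs n"
    using skew_pair_in transversal_ground[OF T] a b by blast+
  moreover have "{a, star a} \<noteq> {b, star b}"
    using ab a transversal_not_star[OF T b] by (auto simp: doubleton_eq_iff)
  ultimately show ?thesis
    using B2[OF T] transversal_exchange_pairs[OF T a b ab]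
      transversal_exchange_pairs[OF T b a ab[symmetric]] by metis
qed

lemma basis_cases:
  assumes "B \<in> \<B>"
  obtains "B \<in> transversals n"
  | T a b where "T \<in> transversals n" "a \<in> T" "b \<in> T" "a \<noteq> b" "B = insert (star a) (T - {b})"
proof -
  have "B \<in> transversals n \<union> almost_transversals n" using assms bases_subset by blast
  then show ?thesis using that unfolding Un_iff almost_transversals_iff by blast
qed

lemma basis_ground: "B \<in> \<B> \<Longrightarrow> B \<subseteq> ground n"
  using bases_subset unfolding transversals_def almost_transversals_def by blast

text \<open>Taking the star of the complement fixes every transversal and interchanges the two sets
  related by (B2).\<close>

lemma dual_basis:
  assumes "B \<in> \<B>"
  shows "star ` (ground n - B) \<in> \<B>"
proof (rule basis_cases[OF assms])
  assume T: "B \<in> transversals n"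
  have "star ` (ground n - B) = B"
  proof (rule set_eqI)
    fix x show "x \<in> star ` (ground n - B) \<longleftrightarrow> x \<in> B"
      using transversal_ground[OF T, of x] transversal_star[OF T, of x] by auto
  qed
  then show ?thesis using assms by simp
next
  fix T a b assume T: "T \<in> transversals n" and a: "a \<in> T" and b: "b \<in> T" and ab: "a \<noteq> b"
    and B: "B = insert (star a) (T - {b})"
  have "star ` (ground n - B) = insert (star b) (T - {a})"
  proof (rule set_eqI)
    fix x show "x \<in> star ` (ground n - B) \<longleftrightarrow> x \<in> insert (star b) (T - {a})"
      using transversal_ground[OF T, of x] transversal_ground[OF T b] transversal_star[OF T, of x]
        transversal_not_star[OF T b] a b ab
      by (auto simp: B star_eq_swap)
  qed
  then show ?thesis using basis_exchange_pairs[OF T a b ab] assms B by simp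
qed

lemma num_skew_pairs_transversal_subset:
  assumes "T \<in> transversals n" "X \<subseteq> T"
  shows "num_skew_pairs n X = 0"
  using num_skew_pairs_mono[OF assms(2), of n] assms(1) by (simp add: transversals_def)

text \<open>The basis is exchanged with its partner under (B2) at \<open>star p\<close>. Only
  \<open>q\<close> and \<open>star q\<close> lie in the partner but not in the basis, so one of them
  replaces \<open>star p\<close>.\<close>

lemma remove_skew_pair:
  assumes T: "T \<in> transversals n" and p: "p \<in> T" and q: "q \<in> T" and pq: "p \<noteq> q"
    and B: "insert (star p) (T - {q}) \<in> \<B>"
  shows "T \<in> \<B> \<or> insert (star q) (T - {q}) \<in> \<B>"
proof -
  have sp: "star p \<notin> T" and sq: "star q \<notin> T"
    using transversal_not_star[OF T] p q by blast+
  let ?B = "insert (star p) (T - {q})" and ?B' = "insert (star q) (T - {p})"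
  have B': "?B' \<in> \<B>" using basis_exchange_pairs[OF T p q pq] B by simp
  have rem: "?B - {star p} = T - {q}" using sp by auto
  have "?B' \<union> {star p} = insert (star q) (insert (star p) (T - {p}))" by blast
  then have one: "num_skew_pairs n (?B' \<union> {star p}) = 1"
    using num_skew_pairs_insert_transversal[OF transversal_swap[OF T p], of q] q pq by auto
  have free: "num_skew_pairs n (?B - {star p}) = 0"
    unfolding rem using num_skew_pairs_transversal_subset[OF T] by blast
  have "star p \<in> ?B - ?B'" using sp pq by auto
  from Exch[OF B B' this free one] obtain f
    where f: "f \<in> ?B' - ?B" "?B - {star p} \<union> {f} \<in> \<B>" by (elim bexE conjE)
  then have "f = q \<or> f = star q" by blast
  then show ?thesis
    using f(2) q unfolding rem by (auto simp: insert_absorb)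
qed

text \<open>As \<open>X\<close> has no skew pair, it avoids an element of the skew pair of
  \<open>B\<close>, and \<open>remove_skew_pair\<close> replaces that element by one from the missed
  pair.\<close>

lemma transversal_basis:
  assumes B: "B \<in> \<B>" and X: "X \<subseteq> B" "\<forall>x\<in>X. star x \<notin> X"
  shows "\<exists>T\<in>\<B>. T \<in> transversals n \<and> X \<subseteq> T"
proof (rule basis_cases[OF B])
  assume "B \<in> transversals n"
  then show ?thesis using B X by blast
next
  have *: ?thesis if T: "T \<in> transversals n" and p: "p \<in> T" and q: "q \<in> T" and pq: "p \<noteq> q"
    and BT: "B = insert (star p) (T - {q})" and "star p \<notin> X" for T p q
  proof -
    have XT: "X \<subseteq> T - {q}" using X that by blast
    show ?thesis
      using remove_skew_pair[OF T p q pq] B BT transversal_swap[OF T q] T XT by blast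
  qed
  fix T p q assume T: "T \<in> transversals n" and p: "p \<in> T" and q: "q \<in> T" and pq: "p \<noteq> q"
    and BT: "B = insert (star p) (T - {q})"
  show ?thesis
  proof (cases "star p \<in> X")
    case False
    then show ?thesis using * T p q pq BT by blast
  next
    case True
    then have pX: "p \<notin> X" using X(2) by auto
    have "star p \<notin> T" using transversal_not_star[OF T p] .
    then have "B = insert p (insert (star p) (T - {p}) - {q})" "star p \<noteq> q"
      using p q pq BT by auto
    then show ?thesis
      using *[OF transversal_swap[OF T p], of "star p" q] q pq pX by simp
  qed
qed

section \<open>Circuits of an antisymmetric matroid\<close>

lemma circuit_remove:
  assumes "C \<in> circuits n \<B>" "c \<in> C"
  obtains B where "B \<in> \<B>" "C - {c} \<subseteq> B"
proof -
  have C: "C \<subseteq> ground n" "num_skew_pairs n C \<le> 1"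
    "\<And>D. D \<in> circuit_candidates n \<B> \<Longrightarrow> D \<subseteq> C \<Longrightarrow> D = C"
    using assms(1) unfolding circuits_def circuit_candidates_def by blast+
  have "C - {c} \<notin> circuit_candidates n \<B>" using C(3)[of "C - {c}"] assms(2) by blast
  moreover have "num_skew_pairs n (C - {c}) \<le> 1"
    using num_skew_pairs_mono[of "C - {c}" C n] C(2) by auto
  ultimately show ?thesis using that C(1) unfolding circuit_candidates_def by blast
qed

lemma circuit_not_subset: "C \<in> circuits n \<B> \<Longrightarrow> B \<in> \<B> \<Longrightarrow> \<not> C \<subseteq> B"
  unfolding circuits_def circuit_candidates_def by blast

lemma circuit_skew_unique:
  assumes "C \<in> circuits n \<B>" "x \<in> C" "star x \<in> C" "y \<in> C" "star y \<in> C"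
  shows "y = x \<or> y = star x"
proof -
  have "C \<subseteq> ground n" "num_skew_pairs n C \<le> 1"
    using assms(1) unfolding circuits_def circuit_candidates_def by blast+
  then show ?thesis using num_skew_pairs_le_1 assms by blast
qed

text \<open>Exchange with \<open>B'\<close> is only available at an \<open>x\<close> for which \<open>B' \<union> {x}\<close> has one skew pair.
  A basis containing \<open>C - {x}\<close> can violate this only if it has the skew pair \<open>{a, a\<^sup>*}\<close> of \<open>C\<close> and
  contains \<open>x\<^sup>*\<close>; then \<open>x\<^sup>*\<close> has to be replaced by an element of the missing pair \<open>{b, b\<^sup>*}\<close>.\<close>

lemma circuit_remove_one_skew:
  assumes C: "C \<in> circuits n \<B>" and x: "x \<in> C"
  obtains B where "B \<in> \<B>" "C - {x} \<subseteq> B" "num_skew_pairs n (insert x B) = 1"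
proof -
  obtain B where B: "B \<in> \<B>" "C - {x} \<subseteq> B" using circuit_remove[OF C x] .
  have Cg: "C \<subseteq> ground n" using C unfolding circuits_def circuit_candidates_def by blast
  have xg: "x \<in> ground n" using Cg x by blast
  show ?thesis
  proof (cases "\<forall>y\<in>C - {x}. star y \<notin> C - {x}")
    case True
    obtain T where T: "T \<in> \<B>" "T \<in> transversals n" "C - {x} \<subseteq> T"
      using transversal_basis[OF B True] by (elim bexE conjE)
    have "x \<notin> T" using circuit_not_subset[OF C T(1)] T(3) by blast
    then have "star x \<in> T" using transversal_star[OF T(2) xg] by simp
    then show ?thesis using that[OF T(1,3)] num_skew_pairs_insert_transversal[OF T(2)] by fastforce
  next
    case False
    then obtain c where c: "c \<in> C - {x}" "star c \<in> C - {x}" by blast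
    have xB: "x \<notin> B" using circuit_not_subset[OF C B(1)] B(2) by blast
    have "B \<notin> transversals n" using c B(2) transversal_not_star by blast
    then obtain T a b where T: "T \<in> transversals n" and a: "a \<in> T" and b: "b \<in> T" and ab: "a \<noteq> b"
      and BT: "B = insert (star a) (T - {b})"
      using basis_cases[OF B(1)] by blast
    have nst: "star y \<notin> T" if "y \<in> T" for y using transversal_not_star[OF T that] .
    have "c \<in> insert (star a) T" "star c \<in> insert (star a) T" using c B(2) BT by blast+
    then have "c = a \<or> c = star a" using insert_star_transversal[OF T a] by blast
    then have aC: "a \<in> C" "star a \<in> C" "a \<noteq> x" "star a \<noteq> x" using c by auto
    show ?thesis
    proof (cases "x = b \<or> x = star b")
      case True
      then have "num_skew_pairs n (insert x B) = 1"
      proof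
        assume "x = b"
        then have "insert x B = insert (star a) T" using b BT by blast
        then show ?thesis using num_skew_pairs_insert_transversal[OF T a] by simp
      next
        assume "x = star b"
        then have "insert x B = insert (star a) (insert (star b) (T - {b}))" using BT by blast
        then show ?thesis
          using num_skew_pairs_insert_transversal[OF transversal_swap[OF T b], of a] a ab by simp
      qed
      then show ?thesis using that B by blast
    next
      case False
      \<comment> \<open>Now \<open>insert x B\<close> has two skew pairs, those of \<open>a\<close>
        and of \<open>x\<close>. The aim is to remove \<open>s\<close> from
        \<open>B\<close>.\<close>
      define s where "s = star x"
      have xT: "x \<notin> T" using xB BT False by blast
      then have s: "s \<in> T" "x = star s" using transversal_star[OF T xg] by (simp_all add: s_def)
      have sb: "s \<noteq> b" and sa: "s \<noteq> a" using False aC by (auto simp: s_def)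
      have sC: "s \<notin> C"
        using circuit_skew_unique[OF C aC(1,2), of x] x aC by (auto simp: s_def)
      have saT: "star a \<notin> T" using nst a by blast
      \<comment> \<open>\<open>star a\<close> leaves \<open>B\<close> by exchange with a transversal
        basis containing \<open>C - {star a}\<close>. The element \<open>f\<close> that enters must
        lie in \<open>C\<close>, or the other new basis would contain \<open>C\<close>; as
        \<open>C - {x}\<close> lies in \<open>B\<close>, only \<open>f = x\<close> remains.\<close>
      have "insert x (T - {b}) \<in> \<B>"
      proof -
        obtain B0 where B0: "B0 \<in> \<B>" "C - {star a} \<subseteq> B0" using circuit_remove[OF C aC(2)] .
        have "\<forall>y\<in>C - {star a}. star y \<notin> C - {star a}"
          using circuit_skew_unique[OF C aC(1,2)] by (metis DiffD1 DiffD2 singletonI)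
        then obtain T2 where T2: "T2 \<in> \<B>" "T2 \<in> transversals n" "C - {star a} \<subseteq> T2"
          using transversal_basis[OF B0] by blast
        have aT2: "a \<in> T2" using aC T2 by auto
        have "star a \<notin> T2" using transversal_not_star[OF T2(2) aT2] .
        moreover have rem: "B - {star a} = T - {b}" using BT saT by blast
        moreover have "num_skew_pairs n (T - {b}) = 0"
          using num_skew_pairs_transversal_subset[OF T] by blast
        ultimately obtain f where f: "f \<in> T2 - B" "T - {b} \<union> {f} \<in> \<B>" "T2 \<union> {star a} - {f} \<in> \<B>"
          using Exch[OF B(1) T2(1), of "star a"] num_skew_pairs_insert_transversal[OF T2(2) aT2] BT
          by auto
        have "f \<in> C" using circuit_not_subset[OF C f(3)] T2(3) by blast
        then have "f = x" using f(1) B(2) by blast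
        then show ?thesis using f(2) by simp
      qed
      moreover have "insert s (insert x (T - {s}) - {b}) = insert x (T - {b})"
        using s(1) sb xT False by blast
      ultimately have *: "insert s (insert x (T - {s}) - {b}) \<in> \<B>" by simp
      \<comment> \<open>Seen from \<open>T1\<close>, the basis just found has the skew pair
        \<open>{x, s}\<close> and misses the pair of \<open>b\<close>, so
        \<open>remove_skew_pair\<close> yields a transversal basis \<open>G\<close>.\<close>
      define T1 where "T1 = insert x (T - {s})"
      have T1: "T1 \<in> transversals n" using transversal_swap[OF T s(1)] s(2) by (simp add: T1_def)
      have b1: "b \<in> T1" and x1: "x \<in> T1" and a1: "a \<in> T1" using b sb a sa by (auto simp: T1_def)
      have xb: "x \<noteq> b" using False by blast
      have sT1: "star x = s" by (simp add: s_def)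
      obtain \<beta> G where G: "G \<in> \<B>" "G \<in> transversals n" "G = insert \<beta> (T1 - {b})"
        and \<beta>: "\<beta> = b \<or> \<beta> = star b"
      proof -
        have "T1 \<in> \<B> \<or> insert (star b) (T1 - {b}) \<in> \<B>"
          using remove_skew_pair[OF T1 x1 b1 xb] * sT1 by (simp add: T1_def)
        then show ?thesis
          using that[of T1 b] that[of "insert (star b) (T1 - {b})" "star b"] b1 T1
            transversal_swap[OF T1 b1] by (auto simp: insert_absorb)
      qed
      have \<beta>B: "\<beta> \<notin> B" and \<beta>T1: "\<beta> \<notin> T1 - {b}"
        using \<beta> BT ab a b saT nst[OF b] transversal_not_star[OF T1 b1] by auto
      have aG: "a \<in> G" using a1 ab G by blast
      have "num_skew_pairs n (B \<union> {\<beta>}) = 1"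
        using \<beta>
      proof
        assume "\<beta> = b"
        then have "B \<union> {\<beta>} = insert (star a) T" using b BT by blast
        then show ?thesis using num_skew_pairs_insert_transversal[OF T a] by simp
      next
        assume "\<beta> = star b"
        then have "B \<union> {\<beta>} = insert (star a) (insert (star b) (T - {b}))" using BT by blast
        then show ?thesis
          using num_skew_pairs_insert_transversal[OF transversal_swap[OF T b], of a] a ab by simp
      qed
      moreover have rem: "G - {\<beta>} = T1 - {b}" using G(3) \<beta>T1 by blast
      moreover have "num_skew_pairs n (T1 - {b}) = 0"
        using num_skew_pairs_transversal_subset[OF T1] by blast
      moreover have "\<beta> \<in> G - B" using G(3) \<beta>B by blast
      \<comment> \<open>If \<open>star a\<close> left \<open>B\<close> in exchange for
        \<open>\<beta>\<close>, then \<open>star a\<close> would complete \<open>T1 - {b}\<close> to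
        a basis containing \<open>C\<close>. So \<open>s\<close> leaves.\<close>
      ultimately obtain f where f: "f \<in> B - G" "T1 - {b} \<union> {f} \<in> \<B>" "B \<union> {\<beta>} - {f} \<in> \<B>"
        using Exch[OF G(1) B(1), of \<beta>] by auto
      have "f = star a \<or> f = s" using f(1) BT G(3) by (auto simp: T1_def)
      moreover have "f \<noteq> star a"
      proof
        assume "f = star a"
        then have "C \<subseteq> T1 - {b} \<union> {f}" using B(2) BT sC xb by (auto simp: T1_def)
        then show False using circuit_not_subset[OF C f(2)] by blast
      qed
      ultimately have fs: "f = s" by blast
      then have "C - {x} \<subseteq> B \<union> {\<beta>} - {f}" using B(2) sC by blast
      moreover have "insert x (B \<union> {\<beta>} - {f}) = insert (star a) G"
        using fs BT G(3) xb sa s saT \<beta> sb nst[OF s(1)] nst[OF b] by (auto simp: T1_def)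
      ultimately show ?thesis
        using that[OF f(3)] num_skew_pairs_insert_transversal[OF G(2) aG] by simp
    qed
  qed
qed

text \<open>If \<open>C \<inter> D\<^sup>* = {x}\<close>, the dual \<open>G\<close> of a basis containing \<open>D - {x\<^sup>*}\<close> meets \<open>D\<^sup>*\<close> only in \<open>x\<close>.
  Exchanging \<open>x\<close> with an element of a basis containing \<open>C - {x}\<close> makes \<open>G\<close> disjoint
  from \<open>D\<^sup>*\<close>, and then the dual of \<open>G\<close> contains \<open>D\<close>.\<close>

lemma circuit_orth:
  assumes C: "C \<in> circuits n \<B>" and D: "D \<in> circuits n \<B>"
  shows "card (C \<inter> star ` D) \<noteq> 1"
proof
  assume "card (C \<inter> star ` D) = 1"
  then obtain x where CD: "C \<inter> star ` D = {x}" by (auto simp: card_1_singleton_iff)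
  then have "x \<in> C \<inter> star ` D" by simp
  then have xC: "x \<in> C" and xD: "star x \<in> D" by simp_all
  have only: "y = x" if "y \<in> C" "star y \<in> D" for y
    using CD that by (metis IntI singletonD star_image_iff)
  have Dg: "D \<subseteq> ground n" using D unfolding circuits_def circuit_candidates_def by blast
  then have xg: "x \<in> ground n" using xD by (metis star_ground subsetD)
  obtain B1 where B1: "B1 \<in> \<B>" "C - {x} \<subseteq> B1" "num_skew_pairs n (insert x B1) = 1"
    using circuit_remove_one_skew[OF C xC] .
  obtain B2 where B2: "B2 \<in> \<B>" "D - {star x} \<subseteq> B2" "num_skew_pairs n (insert (star x) B2) = 1"
    using circuit_remove_one_skew[OF D xD] .
  have x1: "x \<notin> B1" using circuit_not_subset[OF C B1(1)] B1(2) by blast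
  have x2: "star x \<notin> B2" using circuit_not_subset[OF D B2(1)] B2(2) by blast
  define G where "G = star ` (ground n - B2)"
  have G: "G \<in> \<B>" using dual_basis[OF B2(1)] by (simp add: G_def)
  have G_iff: "y \<in> G \<longleftrightarrow> y \<in> ground n \<and> star y \<notin> B2" for y by (simp add: G_def)
  have xG: "x \<in> G" using x2 xg by (simp add: G_iff)
  have "B2 \<in> transversals n \<union> almost_transversals n" using B2(1) bases_subset by blast
  \<comment> \<open>This prepares the exchange at \<open>x\<close>. As
    \<open>insert (star x) B2\<close> has a single skew pair, \<open>G\<close> is either a
    transversal or a transversal with \<open>p\<close> replaced by \<open>x\<close>.\<close>
  then have "\<exists>T\<in>transversals n. G - {x} \<subseteq> T"
  proof (rule insert_one_skew[OF _ _ x2 B2(3)])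
    show "star x \<in> ground n" using xg by simp
    show ?thesis if T: "T \<in> transversals n" "B2 = T" for T
      using transversal_star[OF T(1)] T by (intro bexI[OF _ T(1)]) (auto simp: G_iff)
    show ?thesis if T: "T \<in> transversals n" and "star x \<in> T" "B2 = insert (star p) (T - {star x})" for T p
      using transversal_star[OF T] that by (intro bexI[OF _ T]) (auto simp: G_iff)
  qed
  then have "num_skew_pairs n (G - {x}) = 0" using num_skew_pairs_transversal_subset by blast
  then obtain f where f: "f \<in> B1 - G" "G - {x} \<union> {f} \<in> \<B>" "B1 \<union> {x} - {f} \<in> \<B>"
    using Exch[OF G B1(1), of x] B1(3) x1 xG by auto
  \<comment> \<open>Otherwise the second new basis would contain \<open>C\<close>. Being in
    \<open>C\<close> and different from \<open>x\<close>, the element \<open>f\<close> lies outside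
    the star of \<open>D\<close>.\<close>
  have fC: "f \<in> C" using circuit_not_subset[OF C f(3)] B1(2) by blast
  have fx: "f \<noteq> x" using f(1) x1 by blast
  have "D \<subseteq> star ` (ground n - (G - {x} \<union> {f}))"
  proof
    fix y assume y: "y \<in> D"
    have "star y \<noteq> f" using only[OF fC] fx y by auto
    moreover have "star y \<notin> G - {x}" using y B2(2) by (auto simp: G_iff)
    moreover have "y \<in> ground n" using y Dg by blast
    ultimately show "y \<in> star ` (ground n - (G - {x} \<union> {f}))" by auto
  qed
  then show False using circuit_not_subset[OF D dual_basis[OF f(2)]] by blast
qed

text \<open>\<open>insert e T\<close> has \<open>n + 1\<close> elements and so lies in no basis; a
  minimal candidate below it exists by finiteness.\<close>

lemma circuit_max:
  assumes T: "T \<in> transversals n" and e: "e \<in> star ` T"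
  shows "\<exists>C\<in>circuits n \<B>. C \<subseteq> T \<union> {e}"
proof -
  have se: "star e \<in> T" using e by simp
  let ?W = "insert e T"
  have eg: "e \<in> ground n" using transversal_ground[OF T se] by simp
  have Wg: "?W \<subseteq> ground n" using eg transversal_ground[OF T] by blast
  have "num_skew_pairs n ?W = 1" using num_skew_pairs_insert_transversal[OF T se] by simp
  moreover have "\<not> ?W \<subseteq> B" if "B \<in> \<B>" for B
  proof
    assume "?W \<subseteq> B"
    moreover have "finite B" using basis_ground[OF that] by (rule finite_subset) simp
    moreover have "card B = n"
      using that bases_subset unfolding transversals_def almost_transversals_def by blast
    ultimately have "card ?W \<le> n" by (metis card_mono)
    moreover have "e \<notin> T" using transversal_not_star[OF T se] by simp
    moreover have "finite T" "card T = n"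
      using Wg T by (auto simp: transversals_def intro: finite_subset)
    ultimately show False by simp
  qed
  ultimately have W: "?W \<in> circuit_candidates n \<B>" unfolding circuit_candidates_def using Wg by auto
  have "finite (circuit_candidates n \<B>)"
    by (rule finite_subset[of _ "Pow (ground n)"]) (auto simp: circuit_candidates_def)
  from finite_has_minimal2[OF this W] obtain C
    where "C \<in> circuit_candidates n \<B>" "C \<subseteq> ?W"
      "\<forall>D\<in>circuit_candidates n \<B>. D \<subseteq> C \<longrightarrow> C = D" by (elim bexE conjE)
  then have "C \<in> circuits n \<B>" unfolding circuits_def by blast
  then show ?thesis using \<open>C \<subseteq> ?W\<close> by auto
qed

lemma circuit_nonempty: "{} \<notin> circuits n \<B>"
  using B1 circuit_not_subset by blast

end

lemma circuits_antichain: "C \<in> circuits n \<B> \<Longrightarrow> D \<in> circuits n \<B> \<Longrightarrow> C \<subseteq> D \<Longrightarrow> C = D"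
  unfolding circuits_def by blast

theorem theorem3p3:
  fixes n :: nat and \<C> :: "elt set set"
  assumes "\<forall>C\<in>\<C>. C \<subseteq> ground n \<and> num_skew_pairs n C \<le> 1"
  shows "(\<exists>\<B>. antisymmetric_matroid n \<B> \<and> \<C> = circuits n \<B>) \<longleftrightarrow>
    {} \<notin> \<C> \<and>
    (\<forall>C\<^sub>1\<in>\<C>. \<forall>C\<^sub>2\<in>\<C>. C\<^sub>1 \<subseteq> C\<^sub>2 \<longrightarrow> C\<^sub>1 = C\<^sub>2) \<and>
    (\<forall>C\<^sub>1\<in>\<C>. \<forall>C\<^sub>2\<in>\<C>. card (C\<^sub>1 \<inter> star ` C\<^sub>2) \<noteq> 1) \<and>
    (\<forall>T\<in>transversals n. \<forall>e\<in>star ` T. \<exists>C\<in>\<C>. C \<subseteq> T \<union> {e})" (is "?L \<longleftrightarrow> ?R")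
proof
  assume ?L
  then obtain \<B> where M: "antisymmetric_matroid n \<B>" and \<C>: "\<C> = circuits n \<B>" by (elim exE conjE)
  interpret antisymmetric_matroid n \<B> by (rule M)
  show ?R
    unfolding \<C> using circuit_nonempty circuits_antichain circuit_orth circuit_max
    by (intro conjI ballI impI)
next
  assume R: ?R
  interpret circuit_system n \<C>
  proof
    have "\<forall>T\<in>transversals n. \<forall>e\<in>star ` T. \<exists>C\<in>\<C>. C \<subseteq> T \<union> {e}" using R by (elim conjE)
    then show "\<exists>C\<in>\<C>. C \<subseteq> T \<union> {e}" if "T \<in> transversals n" "e \<in> star ` T" for T e
      using that by blast
  qed (use assms R in simp_all)
  show ?L using antisymmetric_matroid_bases circuits_bases by (intro exI[of _ bases]) simp
qed

end
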